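(* Let $N\ge 2$ be an integer and let $A$ be an $N\times N$ complex unitary matrix all of whose first-row entries equal $1/\sqrt N$. Let $(W_{n,A})_{n\ge 0}$ be the generalized Walsh functions associated to $A$, and for $f\in L^1[0,1]$ and $q\ge1$ put $S_{N^q}(f)=\sum_{n=0}^{N^q-1}\langle f, W_{n,A}\rangle W_{n,A}$. Let $1\le p\le\infty$ and $f\in L^p[0,1]$. Then $S_{N^q}(f)\to f$ almost everywhere in $[0,1]$ as $q\to\infty$. Moreover, if $1<p<\infty$, then $S_{N^q}(f)\to f$ in $L^p[0,1]$ as $q\to\infty$.
   Context: Generalized Walsh functions. Write $A=[a_{ij}]_{0\le i,j\le N-1}$, a complex unitary $N\times N$ matrix with $a_{0j}=1/\sqrt N$ for all $j$. For $0\le i\le N-1$ let $m_i(x)=\sqrt N\sum_{j=0}^{N-1}a_{ij}\chi_{[j/N,(j+1)/N)}(x)$ for $x\in[0,1)$, so $m_0\equiv 1$. Let $r(x)=(Nx)\bmod 1$, i.e. $r(x)=Nx-l$ for $x\in[l/N,(l+1)/N)$, $l\in\{0,\dots,N-1\}$. At the endpoint $x=1$ the convention is $r(1)=1$ and $m_i(1)=\sqrt N a_{i,N-1}$. For an integer $n\ge 0$ with base-$N$ expansion $n=\sum_{k=0}^{s-1}i_kN^k$, $i_k\in\{0,\dots,N-1\}$, set $$W_{n,A}(x)=m_{i_0}(x)\,m_{i_1}(r x)\cdots m_{i_{s-1}}(r^{s-1}x),$$ where $r^k$ is the $k$-fold iterate of $r$; $W_{0,A}\equiv1$. Functions are complex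 valued and $\langle f,g\rangle=\int_0^1 f(t)\overline{g(t)}\,dt$. *)

theory Defs
  imports
    "HOL-Analysis.Analysis"
    "HOL-Probability.Essential_Supremum"
    "Jordan_Normal_Form.Schur_Decomposition"
begin

definition unitary_mat :: "nat \<Rightarrow> complex mat \<Rightarrow> bool" where
  "unitary_mat N A \<longleftrightarrow> A \<in> carrier_mat N N \<and>
     A * mat_adjoint A = 1\<^sub>m N \<and> mat_adjoint A * A = 1\<^sub>m N"

text \<open>Functions are not identified up to null sets. For functions with values in \<^typ>\<open>ennreal\<close>,
  \<^const>\<open>esssup\<close> is the usual essential supremum.\<close>

definition mem_Lp :: "ennreal \<Rightarrow> 'a measure \<Rightarrow> ('a \<Rightarrow> complex) \<Rightarrow> bool" where
  "mem_Lp p M f \<longleftrightarrow> f \<in> borel_measurable M \<and>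
     (if p = \<infinity> then esssup M (\<lambda>x. ennreal (norm (f x))) < \<infinity>
      else (\<integral>\<^sup>+ x. ennreal (norm (f x) powr enn2real p) \<partial>M) < \<infinity>)"

text \<open>The value is the \<open>L\<^sup>p\<close> norm only for \<open>f\<close> in \<open>L\<^sup>p\<close>; otherwise it is a default value.\<close>

definition norm_Lp :: "ennreal \<Rightarrow> 'a measure \<Rightarrow> ('a \<Rightarrow> complex) \<Rightarrow> real" where
  "norm_Lp p M f =
     (if p = \<infinity> then enn2real (esssup M (\<lambda>x. ennreal (norm (f x))))
      else (LINT x|M. norm (f x) powr enn2real p) powr (1 / enn2real p))"

definition tendsto_Lp ::
    "ennreal \<Rightarrow> 'a measure \<Rightarrow> (nat \<Rightarrow> 'a \<Rightarrow> complex) \<Rightarrow> ('a \<Rightarrow> complex) \<Rightarrow> bool" where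
  "tendsto_Lp p M F f \<longleftrightarrow> (\<forall>q. mem_Lp p M (F q)) \<and> mem_Lp p M f \<and>
     (\<lambda>q. norm_Lp p M (\<lambda>x. F q x - f x)) \<longlonglongrightarrow> 0"

abbreviation unit_leb :: "real measure" where
  "unit_leb \<equiv> lebesgue_on {0..1}"

definition inner_L2 :: "(real \<Rightarrow> complex) \<Rightarrow> (real \<Rightarrow> complex) \<Rightarrow> complex" where
  "inner_L2 f g = (LINT t|unit_leb. f t * cnj (g t))"

text \<open>All functions below are meant on \<open>[0,1]\<close>; their values elsewhere are irrelevant.\<close>

definition walsh_m :: "nat \<Rightarrow> complex mat \<Rightarrow> nat \<Rightarrow> real \<Rightarrow> complex" where
  "walsh_m N A i x =
     (if x = 1 then complex_of_real (sqrt (real N)) * A $$ (i, N - 1)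
      else complex_of_real (sqrt (real N)) *
        (\<Sum>j<N. A $$ (i, j) * indicator {real j / real N ..< (real j + 1) / real N} x))"

definition walsh_r :: "nat \<Rightarrow> real \<Rightarrow> real" where
  "walsh_r N x = (if x = 1 then 1 else frac (real N * x))"

text \<open>The length \<open>s\<close> of the base-\<open>N\<close> expansion \<open>n = (\<Sum>k<s. i\<^sub>k * N ^ k)\<close> without leading zeros,
  for \<open>N \<ge> 2\<close>; the digits are \<open>i\<^sub>k = n div N ^ k mod N\<close>, and \<open>s = 0\<close> for \<open>n = 0\<close>.\<close>

definition num_digits :: "nat \<Rightarrow> nat \<Rightarrow> nat" where
  "num_digits N n = (LEAST s. n < N ^ s)"

definition walsh :: "nat \<Rightarrow> complex mat \<Rightarrow> nat \<Rightarrow> real \<Rightarrow> complex" where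
  "walsh N A n x =
     (\<Prod>k<num_digits N n. walsh_m N A (n div N ^ k mod N) ((walsh_r N ^^ k) x))"

definition walsh_sum :: "nat \<Rightarrow> complex mat \<Rightarrow> nat \<Rightarrow> (real \<Rightarrow> complex) \<Rightarrow> real \<Rightarrow> complex" where
  "walsh_sum N A K f x = (\<Sum>n<K. inner_L2 f (walsh N A n) * walsh N A n x)"

end

theory Submission
  imports Defs
begin

text \<open>The partial sums at the powers of \<open>N\<close> are means of \<open>f\<close>, because their Dirichlet kernel
\<open>\<Sum>n<N ^ q. W\<^sub>n(x) cnj (W\<^sub>n(t))\<close> is a product. Reading \<open>n\<close> through its \<open>q\<close> digits (leading zeros are harmless because \<open>m\<^sub>0 = 1\<close>) turns it into the product over \<open>k < q\<close> of
\<open>\<Sum>i<N. m\<^sub>i(r\<^sup>k x) cnj (m\<^sub>i(r\<^sup>k t))\<close>, and since the columns of \<open>A\<close> are orthonormal, each factor is \<open>N\<close> or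
\<open>0\<close> according to whether \<open>x\<close> and \<open>t\<close> have the same \<open>k\<close>-th base-\<open>N\<close> digit. Hence (\<open>walsh_kernel\<close>) the kernel is
\<open>N ^ q\<close> times the indicator of the \<open>N\<close>-adic interval of length \<open>1 / N ^ q\<close> around \<open>x\<close>, whatever \<open>A\<close> is, and
the partial sum is the mean \<open>E\<^sub>q f\<close> of \<open>f\<close> over that interval (\<open>walsh_sum_eq_cell_avg\<close>).

What remains is differentiation along \<open>N\<close>-adic intervals, carried out on the whole real line for functions
extended by zero. Almost everywhere convergence (\<open>AE_cell_avg_tendsto\<close>) follows the classical scheme:
convergence is clear at points of continuity, continuous functions are dense in \<open>L\<^sup>1\<close>, and the weak-type bound
\<open>cell_maximal_inequality\<close> makes almost everywhere convergence stable under \<open>L\<^sup>1\<close> limits. A stopping time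
argument proves this bound, because \<open>N\<close>-adic intervals are nested or disjoint.

Convergence in \<open>L\<^sup>p\<close> (\<open>cell_avg_tendsto_Lp\<close>) is deduced from the almost everywhere theorem.
By Jensen's inequality \<open>\<bar>E\<^sub>q f - f\<bar>\<^sup>p\<close> is at most \<open>2\<^sup>p (E\<^sub>q \<bar>f\<bar>\<^sup>p + \<bar>f\<bar>\<^sup>p)\<close>. The function
\<open>\<bar>f\<bar>\<^sup>p\<close> is itself integrable, so the theorem applies to it as well, and as averaging preserves its
integral, Scheffe's lemma gives \<open>E\<^sub>q \<bar>f\<bar>\<^sup>p \<longlonglongrightarrow> \<bar>f\<bar>\<^sup>p\<close> in \<open>L\<^sup>1\<close>. Dominated convergence with these convergent
majorants finishes the proof.\<close>

section \<open>Averages over adic intervals and the maximal inequality\<close>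

text \<open>The \<open>N\<close>-adic interval of level \<open>q\<close> containing \<open>x\<close>. Describing it by an equation of floors makes the
symmetry in \<open>x\<close> and \<open>t\<close> evident, on which the argument with Fubini's theorem rests.\<close>

definition adic_cell :: "nat \<Rightarrow> nat \<Rightarrow> real \<Rightarrow> real set" where
  "adic_cell N q x = {t. \<lfloor>real (N ^ q) * t\<rfloor> = \<lfloor>real (N ^ q) * x\<rfloor>}"

definition cell_avg ::
    "nat \<Rightarrow> nat \<Rightarrow> (real \<Rightarrow> 'a) \<Rightarrow> real \<Rightarrow> 'a::{banach, second_countable_topology}" where
  "cell_avg N q f x = real (N ^ q) *\<^sub>R (LINT t|lebesgue. indicator (adic_cell N q x) t *\<^sub>R f t)"

text \<open>The same mean for functions with values in \<^typ>\<open>ennreal\<close>. The factor \<open>N ^ q\<close> stands under the integral so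
that this is the integral operator of a symmetric kernel.\<close>

definition cell_nn_avg :: "nat \<Rightarrow> nat \<Rightarrow> (real \<Rightarrow> ennreal) \<Rightarrow> real \<Rightarrow> ennreal" where
  "cell_nn_avg N q h x =
     (\<integral>\<^sup>+ t. ennreal (real (N ^ q)) * indicator (adic_cell N q x) t * h t \<partial>lebesgue)"

lemma adic_cell_eq: "t \<in> adic_cell N q x \<Longrightarrow> adic_cell N q t = adic_cell N q x"
  by (simp add: adic_cell_def)

lemma adic_cell_eq_interval:
  assumes "N > 0"
  shows "adic_cell N q x = {of_int \<lfloor>real (N ^ q) * x\<rfloor> / real (N ^ q) ..<
    (of_int \<lfloor>real (N ^ q) * x\<rfloor> + 1) / real (N ^ q)}"
  using assms by (auto simp: adic_cell_def floor_eq_iff field_simps)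

lemma adic_cell_sets [measurable]: "adic_cell N q x \<in> sets borel"
  unfolding adic_cell_def by measurable

lemma adic_cell_sets_lebesgue [measurable]: "adic_cell N q x \<in> sets lebesgue"
  by (simp add: adic_cell_sets)

lemma emeasure_adic_cell:
  assumes "N > 0"
  shows "emeasure lebesgue (adic_cell N q x) = ennreal (1 / real (N ^ q))"
proof -
  have "emeasure lebesgue (adic_cell N q x) = emeasure lborel (adic_cell N q x)"
    by simp
  then show ?thesis
    using assms by (simp add: adic_cell_eq_interval emeasure_lborel_Ico divide_right_mono
        flip: diff_divide_distrib)
qed

lemma dist_in_adic_cell:
  assumes "N > 0" "t \<in> adic_cell N q x"
  shows "\<bar>t - x\<bar> < 1 / real (N ^ q)"
proof -
  have "\<bar>real (N ^ q) * t - real (N ^ q) * x\<bar> < 1"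
    using assms(2) unfolding adic_cell_def mem_Collect_eq by linarith
  then have "real (N ^ q) * \<bar>t - x\<bar> < 1"
    by (simp add: abs_mult flip: right_diff_distrib)
  then show ?thesis
    using assms(1) by (simp add: field_simps)
qed

text \<open>The integer \<open>b \<lfloor>a\<rfloor>\<close> lies below \<open>b a\<close>, hence below \<open>\<lfloor>b a\<rfloor>\<close>, which is also the floor of \<open>b c\<close>; dividing by
\<open>b\<close> shows that \<open>\<lfloor>a\<rfloor> \<le> c\<close>.\<close>

lemma floor_le_of_floor_mult_eq:
  fixes a b c :: real
  assumes "b = of_int k" "b > 0" "\<lfloor>b * a\<rfloor> = \<lfloor>b * c\<rfloor>"
  shows "\<lfloor>a\<rfloor> \<le> \<lfloor>c\<rfloor>"
proof -
  have "of_int (k * \<lfloor>a\<rfloor>) \<le> b * a"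
    using assms by simp
  then have "of_int (k * \<lfloor>a\<rfloor>) \<le> b * c"
    using assms(3) by (metis le_floor_iff)
  then show ?thesis
    using assms by (simp add: le_floor_iff)
qed

lemma adic_cell_mono:
  assumes "N > 0" "k \<le> q" "t \<in> adic_cell N q x"
  shows "t \<in> adic_cell N k x"
proof -
  have e: "real (N ^ q) * y = real (N ^ (q - k)) * (real (N ^ k) * y)" for y
    using assms(2) by (simp flip: power_add mult.assoc)
  have "\<lfloor>real (N ^ (q - k)) * (real (N ^ k) * t)\<rfloor> = \<lfloor>real (N ^ (q - k)) * (real (N ^ k) * x)\<rfloor>"
    using assms(3) by (simp only: adic_cell_def mem_Collect_eq e)
  moreover have "real (N ^ (q - k)) = of_int (int (N ^ (q - k)))" "real (N ^ (q - k)) > 0"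
    using assms(1) by simp_all
  ultimately show ?thesis
    unfolding adic_cell_def mem_Collect_eq by (metis floor_le_of_floor_mult_eq order_antisym)
qed

lemma sigma_finite_lebesgue: "sigma_finite_measure (lebesgue :: real measure)"
proof
  obtain A :: "real set set" where A: "countable A" "A \<subseteq> sets lborel" "\<Union>A = space lborel"
      "\<forall>a\<in>A. emeasure lborel a \<noteq> \<infinity>"
    using lborel.sigma_finite_countable by auto
  show "\<exists>A::real set set. countable A \<and> A \<subseteq> sets lebesgue \<and> \<Union>A = space lebesgue \<and>
      (\<forall>a\<in>A. emeasure lebesgue a \<noteq> \<infinity>)"
    using A by (intro exI[of _ A]) (auto simp: subset_eq)
qed

lemma adic_kernel_measurable [measurable]:
  "(\<lambda>(x, t). indicator (adic_cell N q x) t :: 'b::{zero_neq_one,topological_space})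
    \<in> borel_measurable (lebesgue \<Otimes>\<^sub>M lebesgue)"
proof -
  have fl: "(\<lambda>x. \<lfloor>real (N ^ q) * x\<rfloor>) \<in> measurable lebesgue (count_space UNIV)"
  proof -
    have "(\<lambda>x::real. \<lfloor>real (N ^ q) * x\<rfloor>) \<in> measurable borel (count_space UNIV)"
      by measurable
    then show ?thesis
      by (metis measurable_completion measurable_lborel2)
  qed
  note [measurable] = measurable_compose[OF measurable_fst fl] measurable_compose[OF measurable_snd fl]
  have "(\<lambda>(x, t). indicator (adic_cell N q x) t :: 'b) =
      (\<lambda>z. if \<lfloor>real (N ^ q) * snd z\<rfloor> = \<lfloor>real (N ^ q) * fst z\<rfloor> then 1 else 0)"
    by (auto simp: fun_eq_iff adic_cell_def)
  also have "\<dots> \<in> borel_measurable (lebesgue \<Otimes>\<^sub>M lebesgue)"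
    by measurable
  finally show ?thesis .
qed

lemma cell_nn_avg_measurable [measurable]:
  assumes [measurable]: "h \<in> borel_measurable lebesgue"
  shows "cell_nn_avg N q h \<in> borel_measurable lebesgue"
proof -
  interpret sigma_finite_measure "lebesgue :: real measure"
    by (rule sigma_finite_lebesgue)
  show ?thesis
    unfolding cell_nn_avg_def[abs_def]
    by (rule borel_measurable_nn_integral) measurable
qed

lemma cell_nn_avg_cong_cell: "t \<in> adic_cell N q x \<Longrightarrow> cell_nn_avg N q h t = cell_nn_avg N q h x"
  by (simp add: cell_nn_avg_def adic_cell_eq)

lemma cell_nn_avg_const_on_cell:
  assumes "N > 0" "\<And>t. t \<in> adic_cell N q x \<Longrightarrow> h t = h x"
  shows "cell_nn_avg N q h x = h x"
proof -
  have "cell_nn_avg N q h x = (\<integral>\<^sup>+ t. (ennreal (real (N ^ q)) * h x) * indicator (adic_cell N q x) t \<partial>lebesgue)"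
    unfolding cell_nn_avg_def using assms(2)
    by (intro nn_integral_cong) (auto simp: indicator_def)
  also have "\<dots> = (ennreal (real (N ^ q)) * h x) * ennreal (1 / real (N ^ q))"
    using emeasure_adic_cell[OF assms(1)] by (subst nn_integral_cmult_indicator) simp_all
  also have "\<dots> = (ennreal (real (N ^ q)) * ennreal (1 / real (N ^ q))) * h x"
    by (simp add: ac_simps)
  also have "ennreal (real (N ^ q)) * ennreal (1 / real (N ^ q)) = 1"
    using assms(1) by (simp flip: ennreal_mult)
  finally show ?thesis by simp
qed

text \<open>Averaging is self-adjoint, by Fubini's theorem and the symmetry of the kernel. Applied to functions \<open>g\<close> that are
constant on the cells, this takes the place of summing over all cells of a given level.\<close>

lemma cell_nn_avg_symmetric:
  assumes [measurable]: "g \<in> borel_measurable lebesgue" "h \<in> borel_measurable lebesgue"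
  shows "(\<integral>\<^sup>+ x. g x * cell_nn_avg N q h x \<partial>lebesgue) = (\<integral>\<^sup>+ x. cell_nn_avg N q g x * h x \<partial>lebesgue)"
proof -
  interpret L: sigma_finite_measure "lebesgue :: real measure"
    by (rule sigma_finite_lebesgue)
  interpret pair_sigma_finite "lebesgue :: real measure" "lebesgue :: real measure" ..
  let ?K = "\<lambda>x t. ennreal (real (N ^ q)) * indicator (adic_cell N q x) t"
  have sym: "?K x t = ?K t x" for x t
    by (auto simp: adic_cell_def indicator_def)
  have m: "(\<lambda>(x, t). g x * (?K x t * h t)) \<in> borel_measurable (lebesgue \<Otimes>\<^sub>M lebesgue)"
    by measurable
  have "(\<integral>\<^sup>+ x. g x * cell_nn_avg N q h x \<partial>lebesgue)
      = (\<integral>\<^sup>+ x. \<integral>\<^sup>+ t. g x * (?K x t * h t) \<partial>lebesgue \<partial>lebesgue)"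
    unfolding cell_nn_avg_def by (intro nn_integral_cong) (subst nn_integral_cmult, simp_all)
  also have "\<dots> = (\<integral>\<^sup>+ t. \<integral>\<^sup>+ x. g x * (?K x t * h t) \<partial>lebesgue \<partial>lebesgue)"
    by (rule Fubini'[OF m, symmetric])
  also have "\<dots> = (\<integral>\<^sup>+ t. \<integral>\<^sup>+ x. (?K t x * g x) * h t \<partial>lebesgue \<partial>lebesgue)"
    by (intro nn_integral_cong) (subst sym, simp add: ac_simps)
  also have "\<dots> = (\<integral>\<^sup>+ t. cell_nn_avg N q g t * h t \<partial>lebesgue)"
    unfolding cell_nn_avg_def by (intro nn_integral_cong) (subst nn_integral_multc, simp_all)
  finally show ?thesis .
qed

lemma nn_integral_cell_nn_avg:
  assumes "N > 0" "h \<in> borel_measurable lebesgue"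
  shows "(\<integral>\<^sup>+ x. cell_nn_avg N q h x \<partial>lebesgue) = (\<integral>\<^sup>+ x. h x \<partial>lebesgue)"
  using cell_nn_avg_symmetric[of "\<lambda>_. 1" h N q] assms
  by (simp add: cell_nn_avg_const_on_cell)

text \<open>A stopping time argument: sort the points where some mean exceeds \<open>c\<close> by the first level \<open>q\<close> at which this
happens. Whether \<open>q\<close> is that first level depends only on the cell of level \<open>q\<close>, since coarser means are constant
there too. So the set \<open>M q\<close> is a union of such cells, and over it \<open>h\<close> has the same integral as its mean of level
\<open>q\<close>, which exceeds \<open>c\<close>. Adding up over the disjoint sets \<open>M q\<close> gives the bound.\<close>

lemma cell_maximal_inequality:
  assumes N: "N > 0" and [measurable]: "h \<in> borel_measurable lebesgue"
  shows "c * emeasure lebesgue {x. \<exists>q. c < cell_nn_avg N q h x} \<le> (\<integral>\<^sup>+ x. h x \<partial>lebesgue)"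
proof -
  define M where "M q = {x. c < cell_nn_avg N q h x \<and> (\<forall>k<q. \<not> c < cell_nn_avg N k h x)}" for q
  have [measurable]: "M q \<in> sets lebesgue" for q
  proof -
    have "{x \<in> space lebesgue. c < cell_nn_avg N q h x \<and> (\<forall>k<q. \<not> c < cell_nn_avg N k h x)} \<in> sets lebesgue"
      by measurable
    then show ?thesis by (simp add: M_def)
  qed
  have disj: "disjoint_family M"
    unfolding disjoint_family_on_def
  proof (intro ballI impI)
    fix m n :: nat assume "m \<noteq> n"
    then show "M m \<inter> M n = {}"
      unfolding M_def by (cases m n rule: linorder_cases) auto
  qed
  have un: "{x. \<exists>q. c < cell_nn_avg N q h x} = (\<Union>q. M q)"
  proof -
    have "\<exists>q. x \<in> M q" if "c < cell_nn_avg N q h x" for x q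
      unfolding M_def using that
      by (intro exI[of _ "LEAST q. c < cell_nn_avg N q h x"]) (auto intro: LeastI dest: not_less_Least)
    then show ?thesis by (auto simp: M_def)
  qed
  have cell: "t \<in> M q \<longleftrightarrow> x \<in> M q" if "t \<in> adic_cell N q x" for t x q
  proof -
    have "cell_nn_avg N k h t = cell_nn_avg N k h x" if "k \<le> q" for k
      using cell_nn_avg_cong_cell adic_cell_mono[OF N that \<open>t \<in> adic_cell N q x\<close>] by blast
    then show ?thesis by (simp add: M_def)
  qed
  have step: "c * emeasure lebesgue (M q) \<le> (\<integral>\<^sup>+ x. indicator (M q) x * h x \<partial>lebesgue)" for q
  proof -
    have "c * emeasure lebesgue (M q) = (\<integral>\<^sup>+ x. c * indicator (M q) x \<partial>lebesgue)"
      by (simp add: nn_integral_cmult_indicator)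
    also have "\<dots> \<le> (\<integral>\<^sup>+ x. indicator (M q) x * cell_nn_avg N q h x \<partial>lebesgue)"
      by (intro nn_integral_mono) (auto simp: M_def indicator_def)
    \<comment> \<open>Move the averaging from \<open>h\<close> to the indicator of \<open>M q\<close>, which it leaves unchanged.\<close>
    also have "\<dots> = (\<integral>\<^sup>+ x. cell_nn_avg N q (indicator (M q)) x * h x \<partial>lebesgue)"
      by (intro cell_nn_avg_symmetric) simp_all
    also have "\<dots> = (\<integral>\<^sup>+ x. indicator (M q) x * h x \<partial>lebesgue)"
      using cell by (subst cell_nn_avg_const_on_cell[OF N]) (auto simp: indicator_def)
    finally show ?thesis .
  qed
  have "c * emeasure lebesgue {x. \<exists>q. c < cell_nn_avg N q h x} = (\<Sum>q. c * emeasure lebesgue (M q))"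
    unfolding un using disj
    by (subst suminf_emeasure[symmetric]) (auto simp: ennreal_suminf_cmult)
  also have "\<dots> \<le> (\<Sum>q. \<integral>\<^sup>+ x. indicator (M q) x * h x \<partial>lebesgue)"
    by (intro suminf_le step) auto
  also have "\<dots> = (\<integral>\<^sup>+ x. (\<Sum>q. indicator (M q) x * h x) \<partial>lebesgue)"
    by (rule nn_integral_suminf[symmetric]) simp
  also have "\<dots> = (\<integral>\<^sup>+ x. indicator (\<Union>q. M q) x * h x \<partial>lebesgue)"
    by (intro nn_integral_cong) (simp add: ennreal_suminf_multc suminf_indicator[OF disj])
  also have "\<dots> \<le> (\<integral>\<^sup>+ x. h x \<partial>lebesgue)"
    by (intro nn_integral_mono) (auto simp: indicator_def)
  finally show ?thesis .
qed

section \<open>Almost everywhere differentiation along adic intervals\<close>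

lemma integrable_on_adic_cell:
  fixes f :: "real \<Rightarrow> 'a::{banach, second_countable_topology}"
  assumes "integrable lebesgue f"
  shows "integrable lebesgue (\<lambda>t. indicator (adic_cell N q x) t *\<^sub>R f t)"
  using assms by (intro integrable_mult_indicator) simp_all

lemma integrable_indicator_adic_cell:
  assumes "N > 0"
  shows "integrable lebesgue (indicator (adic_cell N q x) :: real \<Rightarrow> real)"
  using emeasure_adic_cell[OF assms] by (intro integrable_real_indicator) simp_all

lemma cell_avg_diff:
  assumes "integrable lebesgue f" "integrable lebesgue g"
  shows "cell_avg N q (\<lambda>t. f t - g t) x = cell_avg N q f x - cell_avg N q g x"
  using assms by (simp add: cell_avg_def scaleR_diff_right integrable_on_adic_cell)

lemma cell_avg_add:
  assumes "integrable lebesgue f" "integrable lebesgue g"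
  shows "cell_avg N q (\<lambda>t. f t + g t) x = cell_avg N q f x + cell_avg N q g x"
  using assms by (simp add: cell_avg_def scaleR_add_right integrable_on_adic_cell)

lemma norm_cell_avg_le:
  assumes "integrable lebesgue f"
  shows "ennreal (norm (cell_avg N q f x)) \<le> cell_nn_avg N q (\<lambda>t. ennreal (norm (f t))) x"
proof -
  have [measurable]: "f \<in> borel_measurable lebesgue"
    using assms by simp
  have "ennreal (norm (cell_avg N q f x))
      = ennreal (real (N ^ q)) * ennreal (norm (LINT t|lebesgue. indicator (adic_cell N q x) t *\<^sub>R f t))"
    by (simp add: cell_avg_def ennreal_mult)
  also have "\<dots> \<le> ennreal (real (N ^ q)) *
      (\<integral>\<^sup>+ t. ennreal (norm (indicator (adic_cell N q x) t *\<^sub>R f t)) \<partial>lebesgue)"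
    by (intro mult_left_mono integral_norm_bound_ennreal integrable_on_adic_cell assms) simp
  also have "\<dots> = (\<integral>\<^sup>+ t. ennreal (real (N ^ q)) *
      ennreal (norm (indicator (adic_cell N q x) t *\<^sub>R f t)) \<partial>lebesgue)"
    by (rule nn_integral_cmult[symmetric]) measurable
  also have "\<dots> = cell_nn_avg N q (\<lambda>t. ennreal (norm (f t))) x"
    unfolding cell_nn_avg_def by (intro nn_integral_cong) (auto simp: indicator_def)
  finally show ?thesis .
qed

lemma cell_nn_avg_eq_cell_avg:
  fixes f :: "real \<Rightarrow> real"
  assumes "integrable lebesgue f" "\<And>t. f t \<ge> 0"
  shows "cell_nn_avg N q (\<lambda>t. ennreal (f t)) x = ennreal (cell_avg N q f x)"
proof -
  have "cell_nn_avg N q (\<lambda>t. ennreal (f t)) x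
      = (\<integral>\<^sup>+ t. ennreal (real (N ^ q) * (indicator (adic_cell N q x) t *\<^sub>R f t)) \<partial>lebesgue)"
    unfolding cell_nn_avg_def using assms(2)
    by (intro nn_integral_cong) (auto simp: indicator_def ennreal_mult)
  also have "\<dots> = ennreal (LINT t|lebesgue. real (N ^ q) * (indicator (adic_cell N q x) t *\<^sub>R f t))"
    using assms by (intro nn_integral_eq_integral integrable_mult_right integrable_on_adic_cell) auto
  also have "\<dots> = ennreal (cell_avg N q f x)"
    by (simp add: cell_avg_def)
  finally show ?thesis .
qed

lemma cell_avg_const:
  assumes "N > 0"
  shows "cell_avg N q (\<lambda>_. c) x = c"
  using emeasure_adic_cell[OF assms, of q x] assms
  by (simp add: cell_avg_def measure_def integrable_indicator_adic_cell)

lemma cell_avg_tendsto_at_continuity: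
  fixes g :: "real \<Rightarrow> 'a::{banach, second_countable_topology}"
  assumes N: "N \<ge> 2" and g: "integrable lebesgue g" and cont: "isCont g x"
  shows "(\<lambda>q. cell_avg N q g x) \<longlonglongrightarrow> g x"
proof (rule LIMSEQ_I)
  fix e :: real assume "e > 0"
  then obtain d where d: "d > 0" "\<And>t. \<bar>t - x\<bar> < d \<Longrightarrow> norm (g t - g x) < e / 2"
    using cont unfolding continuous_at_eps_delta
    by (metis dist_norm half_gt_zero real_norm_def)
  have N0: "N > 0" using N by simp
  obtain Q where Q: "(1 / real N) ^ Q < d"
    using real_arch_pow_inv[OF d(1), of "1 / real N"] N by auto
  have "norm (cell_avg N q g x - g x) < e" if "q \<ge> Q" for q
  proof -
    have "1 / real (N ^ q) \<le> (1 / real N) ^ Q"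
      using that N power_decreasing[of Q q "1 / real N"] by (simp add: power_one_over)
    then have close: "norm (g t - g x) < e / 2" if "t \<in> adic_cell N q x" for t
      using dist_in_adic_cell[OF N0 that] Q by (intro d(2)) linarith
    have int: "integrable lebesgue (\<lambda>t. indicator (adic_cell N q x) t *\<^sub>R g x)"
      using integrable_indicator_adic_cell[OF N0] by simp
    have "cell_avg N q g x - g x = cell_avg N q g x - cell_avg N q (\<lambda>_. g x) x"
      by (simp only: cell_avg_const[OF N0])
    also have "\<dots> = real (N ^ q) *\<^sub>R (LINT t|lebesgue. indicator (adic_cell N q x) t *\<^sub>R (g t - g x))"
      unfolding cell_avg_def scaleR_diff_right
      by (subst Bochner_Integration.integral_diff[OF integrable_on_adic_cell[OF g] int]) (simp add: scaleR_diff_right)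
    finally have "norm (cell_avg N q g x - g x)
        = real (N ^ q) * norm (LINT t|lebesgue. indicator (adic_cell N q x) t *\<^sub>R (g t - g x))"
      by simp
    also have "norm (LINT t|lebesgue. indicator (adic_cell N q x) t *\<^sub>R (g t - g x))
        \<le> (LINT t|lebesgue. indicator (adic_cell N q x) t * (e / 2))"
    proof (rule Bochner_Integration.integral_norm_bound_integral)
      show "integrable lebesgue (\<lambda>t. indicator (adic_cell N q x) t *\<^sub>R (g t - g x))"
        using Bochner_Integration.integrable_diff[OF integrable_on_adic_cell[OF g, of N q x] int]
        by (simp add: scaleR_diff_right)
      show "integrable lebesgue (\<lambda>t. indicator (adic_cell N q x) t * (e / 2))"
        using integrable_indicator_adic_cell[OF N0] by simp
    qed (use close in \<open>auto simp: indicator_def less_imp_le\<close>)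
    also have "\<dots> = cell_avg N q (\<lambda>_. e / 2) x / real (N ^ q)"
      using N0 by (simp add: cell_avg_def)
    also have "real (N ^ q) * \<dots> = e / 2"
      using N0 by (simp add: cell_avg_const)
    finally show ?thesis
      using \<open>e > 0\<close> N0 by (simp add: mult_left_mono)
  qed
  then show "\<exists>Q. \<forall>q\<ge>Q. norm (cell_avg N q g x - g x) < e"
    by blast
qed

text \<open>Split \<open>E\<^sub>q f - f\<close> as \<open>E\<^sub>q (f - g) + (E\<^sub>q g - g) + (g - f)\<close>. The middle term tends to zero almost everywhere.
If \<open>g\<close> is close to \<open>f\<close> in \<open>L\<^sup>1\<close>, the set where the first term exceeds \<open>d\<close> for some \<open>q\<close> is small by the maximal
inequality, and the set where the last one is at least \<open>d\<close> is small by Markov's inequality. As \<open>g\<close> varies, the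
exceptional set for \<open>d\<close> is therefore contained in measurable sets of arbitrarily small measure, hence negligible.\<close>

lemma AE_cell_avg_tendsto_L1_closed:
  fixes f :: "real \<Rightarrow> 'a::{banach, second_countable_topology}"
  assumes N: "N > 0" and f: "integrable lebesgue f"
    and approx: "\<And>e. e > 0 \<Longrightarrow> \<exists>g. integrable lebesgue g \<and>
      (AE x in lebesgue. (\<lambda>q. cell_avg N q g x) \<longlonglongrightarrow> g x) \<and>
      (\<integral>\<^sup>+ x. ennreal (norm (f x - g x)) \<partial>lebesgue) \<le> ennreal e"
  shows "AE x in lebesgue. (\<lambda>q. cell_avg N q f x) \<longlonglongrightarrow> f x"
proof -
  have main: "negligible {x. \<not> (\<forall>\<^sub>F q in sequentially. norm (cell_avg N q f x - f x) < 3 * d)}"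
    if d: "d > 0" for d :: real
    unfolding negligible_outer_le
  proof (intro allI impI)
    fix e :: real assume e: "e > 0"
    then obtain g where g: "integrable lebesgue g"
        and conv: "AE x in lebesgue. (\<lambda>q. cell_avg N q g x) \<longlonglongrightarrow> g x"
        and fg: "(\<integral>\<^sup>+ x. ennreal (norm (f x - g x)) \<partial>lebesgue) \<le> ennreal (e * d / 2)"
      using approx[of "e * d / 2"] d by auto
    obtain Z where Z: "Z \<in> null_sets lebesgue" "{x. \<not> (\<lambda>q. cell_avg N q g x) \<longlonglongrightarrow> g x} \<subseteq> Z"
      using conv by (auto simp: eventually_ae_filter)
    define h where "h x = ennreal (norm (f x - g x))" for x
    have [measurable]: "f \<in> borel_measurable lebesgue" "g \<in> borel_measurable lebesgue"
      using f g by auto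
    have hm [measurable]: "h \<in> borel_measurable lebesgue"
      unfolding h_def by measurable
    \<comment> \<open>With the distance \<open>e * d / 2\<close>, each of the two exceptional sets has measure at most \<open>e / 2\<close>.\<close>
    define C D where "C = {x \<in> space lebesgue. \<exists>q. ennreal d < cell_nn_avg N q h x}"
      and "D = {x \<in> space lebesgue. ennreal d \<le> h x}"
    have [measurable]: "C \<in> sets lebesgue" "D \<in> sets lebesgue"
      unfolding C_def D_def by measurable
    have div: "m \<le> ennreal (e / 2)" if "ennreal d * m \<le> ennreal (e * d / 2)" for m
    proof -
      have "ennreal (1 / d) * (ennreal d * m) \<le> ennreal (1 / d) * ennreal (e * d / 2)"
        using that by (rule mult_left_mono) simp
      moreover have "ennreal (1 / d) * ennreal d = 1"
        using d by (simp flip: ennreal_mult)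
      moreover have "ennreal (1 / d) * ennreal (e * d / 2) = ennreal (e / 2)"
        using d e by (simp flip: ennreal_mult)
      ultimately show ?thesis
        by (simp flip: mult.assoc)
    qed
    have "ennreal d * emeasure lebesgue C \<le> ennreal (e * d / 2)"
      using cell_maximal_inequality[OF N hm, of "ennreal d"] fg
      by (simp add: C_def h_def)
    then have C: "emeasure lebesgue C \<le> ennreal (e / 2)"
      by (rule div)
    have "ennreal d * emeasure lebesgue D = (\<integral>\<^sup>+ x. ennreal d * indicator D x \<partial>lebesgue)"
      by (simp add: nn_integral_cmult_indicator)
    also have "\<dots> \<le> (\<integral>\<^sup>+ x. h x \<partial>lebesgue)"
      by (intro nn_integral_mono) (auto simp: D_def indicator_def)
    finally have D: "emeasure lebesgue D \<le> ennreal (e / 2)"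
      using fg by (intro div) (simp add: h_def)
    define T where "T = C \<union> D \<union> Z"
    have [measurable]: "Z \<in> sets lebesgue" using Z by auto
    have "emeasure lebesgue T = emeasure lebesgue (C \<union> D)"
      unfolding T_def by (rule emeasure_Un_null_set) (use Z in auto)
    also have "\<dots> \<le> emeasure lebesgue C + emeasure lebesgue D"
      by (rule emeasure_subadditive) auto
    also have "\<dots> \<le> ennreal (e / 2) + ennreal (e / 2)"
      by (intro add_mono C D)
    also have "\<dots> = ennreal e"
      using e by (simp flip: ennreal_plus)
    finally have T: "emeasure lebesgue T \<le> ennreal e" .
    have "T \<in> lmeasurable"
      using T by (auto simp: fmeasurable_def T_def intro: le_less_trans)
    moreover have "measure lebesgue T \<le> e"
      using T e by (simp add: measure_def enn2real_leI)
    moreover have "\<forall>\<^sub>F q in sequentially. norm (cell_avg N q f x - f x) < 3 * d" if "x \<notin> T" for x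
    proof -
      have "(\<lambda>q. cell_avg N q g x) \<longlonglongrightarrow> g x"
        using that Z by (auto simp: T_def)
      then have "\<forall>\<^sub>F q in sequentially. norm (cell_avg N q g x - g x) < d"
        using d by (auto simp: tendsto_iff dist_norm)
      then show ?thesis
      proof eventually_elim
        case (elim q)
        have "ennreal (norm (cell_avg N q f x - cell_avg N q g x)) \<le> cell_nn_avg N q h x"
          using norm_cell_avg_le[of "\<lambda>t. f t - g t" N q x] f g
          by (simp add: cell_avg_diff h_def[abs_def])
        also have "\<dots> \<le> ennreal d"
          using that by (auto simp: T_def C_def not_less)
        finally have "norm (cell_avg N q f x - cell_avg N q g x) \<le> d"
          using d by (simp add: ennreal_le_iff)
        moreover have "norm (f x - g x) < d"
          using that d by (auto simp: T_def D_def h_def not_le ennreal_less_iff)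
        ultimately show ?case
          using elim by norm
      qed
    qed
    ultimately show "\<exists>T. {x. \<not> (\<forall>\<^sub>F q in sequentially. norm (cell_avg N q f x - f x) < 3 * d)} \<subseteq> T \<and>
        T \<in> lmeasurable \<and> measure lebesgue T \<le> e"
      by (intro exI[of _ T]) auto
  qed
  have "AE x in lebesgue. \<forall>n. \<forall>\<^sub>F q in sequentially. norm (cell_avg N q f x - f x) < 3 * (1 / real (Suc n))"
    unfolding AE_all_countable
  proof
    fix n
    show "AE x in lebesgue. \<forall>\<^sub>F q in sequentially. norm (cell_avg N q f x - f x) < 3 * (1 / real (Suc n))"
      using main[of "1 / real (Suc n)"]
      by (intro AE_I'[of "{x. \<not> (\<forall>\<^sub>F q in sequentially. norm (cell_avg N q f x - f x) < 3 * (1 / real (Suc n)))}"])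
        (auto simp: negligible_iff_null_sets)
  qed
  then show ?thesis
  proof eventually_elim
    case (elim x)
    show ?case
    proof (rule tendstoI)
      fix e :: real assume "e > 0"
      then obtain n where "1 / real (Suc n) < e / 3"
        using nat_approx_posE[of "e / 3"] by auto
      with elim[rule_format, of n] show "\<forall>\<^sub>F q in sequentially. dist (cell_avg N q f x) (f x) < e"
        by (auto elim!: eventually_mono simp: dist_norm)
    qed
  qed
qed

text \<open>By regularity, \<open>A\<close> lies between a closed set \<open>F\<close> and an open set \<open>U\<close> whose difference is small. A Urysohn function
that is 1 on \<open>F\<close> and 0 outside \<open>U\<close> differs from the indicator of \<open>A\<close> only on \<open>U - F\<close>.\<close>

lemma indicator_L1_approx_continuous:
  fixes c :: "'a::{banach, second_countable_topology}"
  assumes A: "A \<in> sets lebesgue" "emeasure lebesgue A < \<infinity>" and e: "e > 0"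
  shows "\<exists>g :: real \<Rightarrow> 'a. continuous_on UNIV g \<and> integrable lebesgue g \<and>
    (\<integral>\<^sup>+ x. ennreal (norm (indicator A x *\<^sub>R c - g x)) \<partial>lebesgue) \<le> ennreal e"
proof -
  \<comment> \<open>The summand 1 only avoids a division by zero for \<open>c = 0\<close>.\<close>
  define d where "d = e / (2 * (norm c + 1))"
  have d: "d > 0" using e by (simp add: d_def add_nonneg_pos)
  obtain U where U: "open U" "A \<subseteq> U" "U - A \<in> lmeasurable" "emeasure lebesgue (U - A) < ennreal d"
    using sets_lebesgue_outer_open[OF A(1) d] by metis
  obtain F where F: "closed F" "F \<subseteq> A" "A - F \<in> lmeasurable" "emeasure lebesgue (A - F) < ennreal d"
    using sets_lebesgue_inner_closed[OF A(1) d] by metis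
  have "closed (- U)" "F \<inter> - U = {}"
    using U F by auto
  then obtain \<phi> :: "real \<Rightarrow> real" where \<phi>: "continuous_on UNIV \<phi>"
      "\<And>x. \<phi> x \<in> closed_segment 1 0"
      "\<And>x. x \<in> F \<Longrightarrow> \<phi> x = 1" "\<And>x. x \<in> - U \<Longrightarrow> \<phi> x = 0"
    using Urysohn[OF F(1), of "- U" 1 0] by metis
  have \<phi>01: "0 \<le> \<phi> x" "\<phi> x \<le> 1" for x
    using \<phi>(2)[of x] by (simp_all add: closed_segment_eq_real_ivl)
  have [measurable]: "A \<in> sets lebesgue" "U \<in> sets lebesgue" "F \<in> sets lebesgue"
    using A U F by auto
  have "\<phi> \<in> borel_measurable lebesgue"
    using \<phi>(1) by (simp add: borel_measurable_continuous_onI measurable_completion)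
  note [measurable] = this
  have "emeasure lebesgue U \<le> emeasure lebesgue A + emeasure lebesgue (U - A)"
    using emeasure_subadditive[of A lebesgue "U - A"] U(2) by (simp add: Un_absorb1)
  also have "\<dots> < \<infinity>"
    using A(2) U(4) by (simp add: less_top order.strict_trans)
  finally have Ufin: "emeasure lebesgue U < \<infinity>" .
  have int: "integrable lebesgue \<phi>"
    by (rule Bochner_Integration.integrable_bound[of _ "indicator U :: real \<Rightarrow> real"])
      (use Ufin \<phi>(4) \<phi>01 in \<open>auto simp: indicator_def integrable_real_indicator\<close>)
  have "(\<integral>\<^sup>+ x. ennreal (norm (indicator A x *\<^sub>R c - \<phi> x *\<^sub>R c)) \<partial>lebesgue)
      \<le> (\<integral>\<^sup>+ x. ennreal (norm c) * indicator (U - F) x \<partial>lebesgue)"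
  proof (intro nn_integral_mono)
    fix x
    have "norm (indicator A x *\<^sub>R c - \<phi> x *\<^sub>R c) = \<bar>indicator A x - \<phi> x\<bar> * norm c"
      by (simp flip: scaleR_diff_left)
    also have "\<dots> \<le> indicator (U - F) x * norm c"
      using \<phi>01[of x] \<phi>(3,4)[of x] U(2) F(2) by (intro mult_right_mono) (auto simp: indicator_def)
    finally have "ennreal (norm (indicator A x *\<^sub>R c - \<phi> x *\<^sub>R c)) \<le> ennreal (indicator (U - F) x * norm c)"
      by (rule ennreal_leI)
    also have "\<dots> = ennreal (norm c) * indicator (U - F) x"
      by (simp add: indicator_def)
    finally show "ennreal (norm (indicator A x *\<^sub>R c - \<phi> x *\<^sub>R c)) \<le> ennreal (norm c) * indicator (U - F) x" .
  qed
  also have "\<dots> = ennreal (norm c) * emeasure lebesgue (U - F)"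
    by (rule nn_integral_cmult_indicator) simp
  also have "emeasure lebesgue (U - F) \<le> emeasure lebesgue (U - A) + emeasure lebesgue (A - F)"
  proof -
    have "U - F = (U - A) \<union> (A - F)" using U(2) F(2) by auto
    then show ?thesis by (simp only:) (intro emeasure_subadditive; measurable)
  qed
  also have "\<dots> \<le> ennreal d + ennreal d"
    using U(4) F(4) by (intro add_mono) simp_all
  also have "ennreal (norm c) * (ennreal d + ennreal d) = ennreal (norm c * (2 * d))"
    using d by (simp flip: ennreal_plus ennreal_mult)
  also have "\<dots> \<le> ennreal e"
  proof (rule ennreal_leI)
    have "norm c + 1 \<noteq> 0"
      using norm_ge_zero[of c] by linarith
    moreover have "k * (2 * (e / (2 * k))) = e" if "k \<noteq> 0" for k
      using that by simp
    ultimately have "(norm c + 1) * (2 * d) = e"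
      unfolding d_def by blast
    moreover have "norm c * (2 * d) \<le> (norm c + 1) * (2 * d)"
      using d by (intro mult_right_mono) simp_all
    ultimately show "norm c * (2 * d) \<le> e"
      by simp
  qed
  finally have "(\<integral>\<^sup>+ x. ennreal (norm (indicator A x *\<^sub>R c - \<phi> x *\<^sub>R c)) \<partial>lebesgue) \<le> ennreal e"
    by (simp add: mult_left_mono)
  then show ?thesis
    using int \<phi>(1) by (intro exI[of _ "\<lambda>x. \<phi> x *\<^sub>R c"]) (auto intro!: continuous_intros)
qed

text \<open>Integrable functions are built from indicators by sums and dominated limits. Indicators are \<open>L\<^sup>1\<close> limits of continuous
functions, whose means converge everywhere, and dominated limits are \<open>L\<^sup>1\<close> limits, so \<open>L\<^sup>1\<close> closedness serves both
cases.\<close>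

theorem AE_cell_avg_tendsto:
  fixes f :: "real \<Rightarrow> 'a::{banach, second_countable_topology}"
  assumes N: "N \<ge> 2" and f: "integrable lebesgue f"
  shows "AE x in lebesgue. (\<lambda>q. cell_avg N q f x) \<longlonglongrightarrow> f x"
  using f
proof (induction rule: integrable_induct)
  case (base A c)
  show ?case
  proof (rule AE_cell_avg_tendsto_L1_closed)
    show "N > 0" using N by simp
    show "integrable lebesgue (\<lambda>x. indicator A x *\<^sub>R c)"
      using base by simp
    fix e :: real assume "e > 0"
    then obtain g where g: "continuous_on UNIV g" "integrable lebesgue g"
        "(\<integral>\<^sup>+ x. ennreal (norm (indicator A x *\<^sub>R c - g x)) \<partial>lebesgue) \<le> ennreal e"
      using indicator_L1_approx_continuous base by metis
    then have "(\<lambda>q. cell_avg N q g x) \<longlonglongrightarrow> g x" for x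
      using cell_avg_tendsto_at_continuity[OF N g(2)] by (simp add: continuous_on_eq_continuous_at)
    with g show "\<exists>g. integrable lebesgue g \<and>
        (AE x in lebesgue. (\<lambda>q. cell_avg N q g x) \<longlonglongrightarrow> g x) \<and>
        (\<integral>\<^sup>+ x. ennreal (norm (indicator A x *\<^sub>R c - g x)) \<partial>lebesgue) \<le> ennreal e"
      by auto
  qed
next
  case (add f g)
  from add.IH show ?case
    by eventually_elim (use add.hyps in \<open>simp add: cell_avg_add tendsto_add\<close>)
next
  case (lim f s)
  show ?case
  proof (rule AE_cell_avg_tendsto_L1_closed)
    show "N > 0" using N by simp
    fix e :: real assume "e > 0"
    have [measurable]: "f \<in> borel_measurable lebesgue" "s i \<in> borel_measurable lebesgue" for i
      using lim.hyps by auto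
    have "integrable lebesgue (\<lambda>x. 2 * norm (f x))"
      using lim.hyps by simp
    then have "(\<integral>\<^sup>+ x. ennreal (norm (2 * norm (f x))) \<partial>lebesgue) < \<infinity>"
      unfolding integrable_iff_bounded by blast
    then have "(\<integral>\<^sup>+ x. ennreal (2 * norm (f x)) \<partial>lebesgue) < \<infinity>"
      by simp
    with lim.hyps have "(\<lambda>i. \<integral>\<^sup>+ x. ennreal (norm (f x - s i x)) \<partial>lebesgue) \<longlonglongrightarrow> 0"
      by (intro nn_integral_dominated_convergence_norm[where w = "\<lambda>x. 2 * norm (f x)"]) auto
    then have "\<forall>\<^sub>F i in sequentially. (\<integral>\<^sup>+ x. ennreal (norm (f x - s i x)) \<partial>lebesgue) < ennreal e"
      using \<open>e > 0\<close> by (intro order_tendstoD) auto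
    then obtain i where "(\<integral>\<^sup>+ x. ennreal (norm (f x - s i x)) \<partial>lebesgue) < ennreal e"
      by (auto simp: eventually_sequentially)
    then show "\<exists>g. integrable lebesgue g \<and>
        (AE x in lebesgue. (\<lambda>q. cell_avg N q g x) \<longlonglongrightarrow> g x) \<and>
        (\<integral>\<^sup>+ x. ennreal (norm (f x - g x)) \<partial>lebesgue) \<le> ennreal e"
      using lim by (intro exI[of _ "s i"]) auto
  qed (use lim in simp)
qed

section \<open>Convergence of the averages in the mean of order p\<close>

lemma cell_avg_measurable [measurable]:
  assumes [measurable]: "f \<in> borel_measurable lebesgue"
  shows "cell_avg N q f \<in> borel_measurable lebesgue"
proof -
  interpret sigma_finite_measure "lebesgue :: real measure"
    by (rule sigma_finite_lebesgue)
  have "(\<lambda>x. LINT t|lebesgue. indicator (adic_cell N q x) t *\<^sub>R f t) \<in> borel_measurable lebesgue"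
    by (rule borel_measurable_lebesgue_integral) measurable
  then show ?thesis
    unfolding cell_avg_def[abs_def] by measurable
qed

text \<open>Jensen's inequality for the power \<open>r\<close>. With \<open>m\<close> the norm of the mean of \<open>f\<close>, Young's inequality
\<open>m\<^sup>r\<^sup>-\<^sup>1 \<bar>f\<bar> \<le> \<bar>f\<bar>\<^sup>r / r + m\<^sup>r (1 - 1 / r)\<close> expresses that the graph of the power lies above its tangent at
\<open>m\<close>. Averaging it gives \<open>m\<^sup>r \<le> E \<bar>f\<bar>\<^sup>r / r + m\<^sup>r (1 - 1 / r)\<close>, where \<open>m\<^sup>r (1 - 1 / r)\<close> cancels. Values in
\<^typ>\<open>ennreal\<close> allow the mean of \<open>\<bar>f\<bar>\<^sup>r\<close> to be infinite.\<close>

lemma norm_cell_avg_powr_le: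
  fixes f :: "real \<Rightarrow> 'a::{banach, second_countable_topology}"
  assumes N: "N > 0" and f: "integrable lebesgue f" and r: "r \<ge> 1"
  shows "ennreal (norm (cell_avg N q f x) powr r) \<le> cell_nn_avg N q (\<lambda>t. ennreal (norm (f t) powr r)) x"
proof (cases "r = 1")
  case True
  then show ?thesis using norm_cell_avg_le[OF f, of N q x] by simp
next
  case False
  then have r1: "r > 1" using r by simp
  define m where "m = norm (cell_avg N q f x)"
  \<comment> \<open>the conjugate exponent of \<open>r\<close>\<close>
  define s where "s = r / (r - 1)"
  have s: "s > 1" "1 / r + 1 / s = 1" "(r - 1) * s = r"
    using r1 by (simp_all add: s_def field_simps)
  have m0: "m \<ge> 0" by (simp add: m_def)
  have [measurable]: "f \<in> borel_measurable lebesgue" using f by simp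
  have c0: "m powr r * (1 - 1 / r) \<ge> 0" using r1 by simp
  let ?K = "\<lambda>t. ennreal (real (N ^ q)) * indicator (adic_cell N q x) t"
  let ?R = "cell_nn_avg N q (\<lambda>t. ennreal (norm (f t) powr r)) x"
  have young: "m powr (r - 1) * norm (f t) \<le> (1 / r) * norm (f t) powr r + m powr r * (1 - 1 / r)" for t
  proof -
    have "norm (f t) * m powr (r - 1) \<le> norm (f t) powr r / r + (m powr (r - 1)) powr s / s"
      by (rule Youngs_inequality) (use r1 s in auto)
    also have "(m powr (r - 1)) powr s = m powr r"
      by (simp add: powr_powr s)
    also have "m powr r / s = m powr r * (1 - 1 / r)"
    proof -
      have "1 - 1 / r = 1 / s"
        using s(2) by linarith
      then show ?thesis by simp
    qed
    finally show ?thesis by (simp add: ac_simps)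
  qed
  have split: "ennreal ((1 / r) * y + m powr r * (1 - 1 / r))
      = ennreal (1 / r) * ennreal y + ennreal (m powr r * (1 - 1 / r))" if "y \<ge> 0" for y
    using r1 c0 that
    by (subst ennreal_plus) (simp_all add: ennreal_mult[symmetric] del: times_divide_eq_left)
  have "m powr r = m powr (r - 1) * m"
    using m0 r1 by (cases "m = 0") (auto simp: powr_diff)
  then have "ennreal (m powr r) = ennreal (m powr (r - 1)) * ennreal m"
    by (simp add: ennreal_mult m0)
  also have "\<dots> \<le> ennreal (m powr (r - 1)) * cell_nn_avg N q (\<lambda>t. ennreal (norm (f t))) x"
    unfolding m_def by (intro mult_left_mono norm_cell_avg_le f) simp
  also have "\<dots> = (\<integral>\<^sup>+ t. ?K t * ennreal (m powr (r - 1) * norm (f t)) \<partial>lebesgue)"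
    unfolding cell_nn_avg_def
    by (subst nn_integral_cmult[symmetric]) (auto intro!: nn_integral_cong simp: ennreal_mult ac_simps)
  also have "\<dots> \<le> (\<integral>\<^sup>+ t. ?K t * ennreal ((1 / r) * norm (f t) powr r + m powr r * (1 - 1 / r)) \<partial>lebesgue)"
    by (intro nn_integral_mono mult_left_mono ennreal_leI young) simp
  also have "\<dots> = (\<integral>\<^sup>+ t. ennreal (1 / r) * (?K t * ennreal (norm (f t) powr r))
      + ?K t * ennreal (m powr r * (1 - 1 / r)) \<partial>lebesgue)"
  proof (intro nn_integral_cong)
    fix t
    show "?K t * ennreal ((1 / r) * norm (f t) powr r + m powr r * (1 - 1 / r))
        = ennreal (1 / r) * (?K t * ennreal (norm (f t) powr r)) + ?K t * ennreal (m powr r * (1 - 1 / r))"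
      by (subst split) (simp_all only: distrib_left powr_ge_zero, simp only: ac_simps)
  qed
  also have "\<dots> = ennreal (1 / r) * ?R + cell_nn_avg N q (\<lambda>_. ennreal (m powr r * (1 - 1 / r))) x"
    unfolding cell_nn_avg_def
    by (subst nn_integral_add, measurable) (subst nn_integral_cmult, measurable)
  also have "cell_nn_avg N q (\<lambda>_. ennreal (m powr r * (1 - 1 / r))) x = ennreal (m powr r * (1 - 1 / r))"
    by (rule cell_nn_avg_const_on_cell[OF N]) simp
  finally have le: "ennreal (m powr r) \<le> ennreal (1 / r) * ?R + ennreal (m powr r * (1 - 1 / r))" .
  show ?thesis
  proof (cases ?R)
    case (real \<rho>)
    have "ennreal (m powr r) \<le> ennreal (1 / r * \<rho> + m powr r * (1 - 1 / r))"
      using le real(1) by (simp only: real(2) split)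
    then have "m powr r \<le> 1 / r * \<rho> + m powr r * (1 - 1 / r)"
      using real r1 c0 by (subst (asm) ennreal_le_iff) auto
    then have "m powr r / r \<le> \<rho> / r"
      by (simp add: right_diff_distrib)
    then have "m powr r \<le> \<rho>"
      using r1 by (simp add: divide_le_cancel)
    then show ?thesis
      unfolding real m_def[symmetric] by (rule ennreal_leI)
  qed simp
qed

lemma norm_diff_powr_le:
  assumes "r \<ge> 0"
  shows "norm (a - b) powr r \<le> 2 powr r * (norm a powr r + norm b powr r)"
proof -
  have "norm (a - b) \<le> 2 * max (norm a) (norm b)"
    using norm_triangle_ineq4[of a b] by linarith
  then have "norm (a - b) powr r \<le> (2 * max (norm a) (norm b)) powr r"
    using assms by (intro powr_mono2) simp_all
  also have "\<dots> = 2 powr r * max (norm a) (norm b) powr r"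
    by (simp add: powr_mult)
  also have "max (norm a) (norm b) powr r \<le> norm a powr r + norm b powr r"
    by (simp add: max_def)
  finally show ?thesis
    by simp
qed

text \<open>Put \<open>u = \<bar>f\<bar>\<^sup>r\<close>. The error \<open>D q\<close> is at most \<open>2\<^sup>r (E\<^sub>q u + u)\<close>, hence at most \<open>2\<^sup>r (2 u + W q)\<close> with
\<open>W q = \<bar>E\<^sub>q u - u\<bar>\<close>. Cutting \<open>D q\<close> off at \<open>2\<^sup>r\<^sup>+\<^sup>1 u\<close> leaves a part \<open>V q\<close> that dominated convergence handles, and
what is cut off is at most \<open>2\<^sup>r W q\<close>, which tends to zero in \<open>L\<^sup>1\<close> by Scheffe's lemma.\<close>

theorem cell_avg_tendsto_Lp:
  fixes f :: "real \<Rightarrow> 'a::{banach, second_countable_topology}"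
  assumes N: "N \<ge> 2" and f: "integrable lebesgue f" and r: "r \<ge> 1"
    and fr: "integrable lebesgue (\<lambda>x. norm (f x) powr r)"
  shows "(\<lambda>q. \<integral>\<^sup>+ x. ennreal (norm (cell_avg N q f x - f x) powr r) \<partial>lebesgue) \<longlonglongrightarrow> 0"
proof -
  have N0: "N > 0" using N by simp
  have [measurable]: "f \<in> borel_measurable lebesgue" using f by simp
  define u where "u x = norm (f x) powr r" for x
  have u0: "u x \<ge> 0" for x by (simp add: u_def)
  have u: "integrable lebesgue u" using fr by (simp add: u_def[abs_def])
  then have [measurable]: "u \<in> borel_measurable lebesgue" by simp
  have nnu: "cell_nn_avg N q (\<lambda>t. ennreal (u t)) x = ennreal (cell_avg N q u x)" for q x
    by (rule cell_nn_avg_eq_cell_avg[OF u u0])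
  have Eu0: "cell_avg N q u x \<ge> 0" for q x
    unfolding cell_avg_def using u0 by (intro scaleR_nonneg_nonneg integral_nonneg_AE) auto
  define D where "D q x = norm (cell_avg N q f x - f x) powr r" for q x
  define V where "V q x = min (D q x) (2 powr r * (2 * u x))" for q x
  define W where "W q x = norm (cell_avg N q u x - u x)" for q x
  have [measurable]: "D q \<in> borel_measurable lebesgue" "V q \<in> borel_measurable lebesgue"
      "W q \<in> borel_measurable lebesgue" for q
    unfolding D_def[abs_def] V_def[abs_def] W_def[abs_def] by measurable
  have jensen: "norm (cell_avg N q f x) powr r \<le> cell_avg N q u x" for q x
    using norm_cell_avg_powr_le[OF N0 f r, of q x] nnu[of q x] Eu0[of q x]
    by (simp add: u_def[abs_def])
  have D_le: "D q x \<le> V q x + 2 powr r * W q x" for q x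
  proof -
    have "D q x \<le> 2 powr r * (norm (cell_avg N q f x) powr r + u x)"
      unfolding D_def u_def using r by (intro norm_diff_powr_le) simp
    also have "\<dots> \<le> 2 powr r * (2 * u x + W q x)"
      using jensen[of q x] by (intro mult_left_mono) (auto simp: W_def)
    finally have "D q x \<le> 2 powr r * (2 * u x) + 2 powr r * W q x"
      by (simp add: distrib_left)
    moreover have "0 \<le> 2 powr r * W q x"
      by (simp add: W_def)
    ultimately show ?thesis
      unfolding V_def by linarith
  qed
  have V0: "0 \<le> V q x" for q x
    using u0[of x] by (simp add: V_def D_def)
  have W_lim: "(\<lambda>q. \<integral>\<^sup>+ x. ennreal (W q x) \<partial>lebesgue) \<longlonglongrightarrow> 0"
    unfolding W_def
  proof (rule Scheffe_lemma2)
    show "AE x in lebesgue. (\<lambda>q. cell_avg N q u x) \<longlonglongrightarrow> u x"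
      by (rule AE_cell_avg_tendsto[OF N u])
    show "(\<integral>\<^sup>+ x. ennreal (norm (cell_avg N q u x)) \<partial>lebesgue) \<le> (\<integral>\<^sup>+ x. ennreal (norm (u x)) \<partial>lebesgue)" for q
      using nn_integral_cell_nn_avg[OF N0, of "\<lambda>x. ennreal (u x)" q] by (simp add: nnu u0 Eu0)
  qed (use u in simp_all)
  have V_lim: "(\<lambda>q. \<integral>\<^sup>+ x. ennreal (V q x) \<partial>lebesgue) \<longlonglongrightarrow> (\<integral>\<^sup>+ x. 0 \<partial>(lebesgue :: real measure))"
  proof (rule nn_integral_dominated_convergence[where w = "\<lambda>x. ennreal (2 powr r * (2 * u x))"])
    have "integrable lebesgue (\<lambda>x. 2 powr r * (2 * u x))"
      using u by simp
    then have "(\<integral>\<^sup>+ x. ennreal (norm (2 powr r * (2 * u x))) \<partial>lebesgue) < \<infinity>"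
      unfolding integrable_iff_bounded by blast
    then show "(\<integral>\<^sup>+ x. ennreal (2 powr r * (2 * u x)) \<partial>lebesgue) < \<infinity>"
      using u0 by simp
    show "AE x in lebesgue. (\<lambda>q. ennreal (V q x)) \<longlonglongrightarrow> 0"
      using AE_cell_avg_tendsto[OF N f]
    proof eventually_elim
      case (elim x)
      then have "(\<lambda>q. norm (cell_avg N q f x - f x)) \<longlonglongrightarrow> 0"
        by (simp add: LIM_zero tendsto_norm_zero)
      then have "(\<lambda>q. D q x) \<longlonglongrightarrow> 0 powr r"
        unfolding D_def using r by (intro tendsto_powr2 tendsto_const) auto
      then have "(\<lambda>q. V q x) \<longlonglongrightarrow> min (0 powr r) (2 powr r * (2 * u x))"
        unfolding V_def by (intro tendsto_min tendsto_const)
      then have "(\<lambda>q. V q x) \<longlonglongrightarrow> 0"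
        using u0[of x] by simp
      then show ?case
        using tendsto_ennrealI by fastforce
    qed
    show "AE x in lebesgue. ennreal (V q x) \<le> ennreal (2 powr r * (2 * u x))" for q
      by (intro AE_I2 ennreal_leI) (simp add: V_def)
  qed simp_all
  have "(\<lambda>q. (\<integral>\<^sup>+ x. ennreal (V q x) \<partial>lebesgue) + ennreal (2 powr r) * (\<integral>\<^sup>+ x. ennreal (W q x) \<partial>lebesgue)) \<longlonglongrightarrow>
      (\<integral>\<^sup>+ x. 0 \<partial>(lebesgue :: real measure)) + ennreal (2 powr r) * 0"
    by (intro tendsto_add V_lim ennreal_tendsto_cmult W_lim) simp
  then have lim: "(\<lambda>q. (\<integral>\<^sup>+ x. ennreal (V q x) \<partial>lebesgue) + ennreal (2 powr r) * (\<integral>\<^sup>+ x. ennreal (W q x) \<partial>lebesgue)) \<longlonglongrightarrow> 0"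
    by simp
  have bound: "(\<integral>\<^sup>+ x. ennreal (D q x) \<partial>lebesgue)
      \<le> (\<integral>\<^sup>+ x. ennreal (V q x) \<partial>lebesgue) + ennreal (2 powr r) * (\<integral>\<^sup>+ x. ennreal (W q x) \<partial>lebesgue)" for q
  proof -
    have "(\<integral>\<^sup>+ x. ennreal (D q x) \<partial>lebesgue)
        \<le> (\<integral>\<^sup>+ x. ennreal (V q x) + ennreal (2 powr r) * ennreal (W q x) \<partial>lebesgue)"
    proof (intro nn_integral_mono)
      fix x
      have "ennreal (D q x) \<le> ennreal (V q x + 2 powr r * W q x)"
        by (intro ennreal_leI D_le)
      also have "\<dots> = ennreal (V q x) + ennreal (2 powr r) * ennreal (W q x)"
        using V0[of q x] by (simp add: ennreal_mult W_def)
      finally show "ennreal (D q x) \<le> ennreal (V q x) + ennreal (2 powr r) * ennreal (W q x)" .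
    qed
    also have "\<dots> = (\<integral>\<^sup>+ x. ennreal (V q x) \<partial>lebesgue) + ennreal (2 powr r) * (\<integral>\<^sup>+ x. ennreal (W q x) \<partial>lebesgue)"
      by (simp add: nn_integral_add nn_integral_cmult)
    finally show ?thesis .
  qed
  show ?thesis
    unfolding D_def[symmetric]
    by (rule tendsto_sandwich[OF _ _ tendsto_const lim]) (use bound in auto)
qed

section \<open>The Walsh-Dirichlet kernel\<close>

text \<open>The Walsh function with the expansion of \<open>n\<close> padded by zeros to \<open>q\<close> digits. A fixed number of factors makes the sum
over all \<open>n < N ^ q\<close> factorise.\<close>

definition digit_prod :: "nat \<Rightarrow> complex mat \<Rightarrow> nat \<Rightarrow> nat \<Rightarrow> real \<Rightarrow> complex" where
  "digit_prod N A q n x = (\<Prod>k<q. walsh_m N A (n div N ^ k mod N) ((walsh_r N ^^ k) x))"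

lemma walsh_m_eq:
  assumes "N > 0" "x \<in> {0..<1}"
  shows "walsh_m N A i x = complex_of_real (sqrt (real N)) * A $$ (i, nat \<lfloor>real N * x\<rfloor>)"
    and "nat \<lfloor>real N * x\<rfloor> < N"
proof -
  let ?d = "nat \<lfloor>real N * x\<rfloor>"
  have "real N * x < real N"
    using assms by simp
  then show d: "?d < N"
    using assms by (simp add: nat_less_iff floor_less_iff)
  have "indicator {real j / real N ..< (real j + 1) / real N} x = (if j = ?d then 1 else (0 :: complex))" for j
  proof -
    have "x \<in> {real j / real N ..< (real j + 1) / real N} \<longleftrightarrow> \<lfloor>real N * x\<rfloor> = int j"
      using assms(1) by (auto simp: floor_eq_iff field_simps)
    also have "\<dots> \<longleftrightarrow> j = ?d"
      using assms by auto
    finally show ?thesis by (simp add: indicator_def)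
  qed
  then show "walsh_m N A i x = complex_of_real (sqrt (real N)) * A $$ (i, ?d)"
    using assms(2) d by (simp add: walsh_m_def if_distrib[where f = "(*) _"] cong: if_cong)
qed

lemma walsh_r_range: "x \<in> {0..<1} \<Longrightarrow> walsh_r N x \<in> {0..<1}"
  by (auto simp: walsh_r_def frac_lt_1)

lemma walsh_r_funpow_range: "x \<in> {0..<1} \<Longrightarrow> (walsh_r N ^^ k) x \<in> {0..<1}"
  by (induction k) (use walsh_r_range in auto)

lemma unitary_columns_orthonormal:
  assumes "unitary_mat N A" "j < N" "l < N"
  shows "(\<Sum>i<N. A $$ (i, j) * cnj (A $$ (i, l))) = (if j = l then 1 else 0)"
proof -
  have A: "A \<in> carrier_mat N N" "mat_adjoint A * A = 1\<^sub>m N"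
    using assms(1) by (auto simp: unitary_mat_def)
  have "(mat_adjoint A * A) $$ (l, j) = (\<Sum>i<N. A $$ (i, j) * cnj (A $$ (i, l)))"
    using A(1) assms(2,3)
    by (auto simp: mat_adjoint_def scalar_prod_def lessThan_atLeast0 mult.commute intro!: sum.cong)
  then show ?thesis
    using A(2) assms(2,3) by auto
qed

text \<open>The orthonormality that matters is that of the columns of \<open>A\<close>: the sum runs over the row index \<open>i\<close>, while the column is
the leading digit of the argument.\<close>

lemma walsh_m_kernel:
  assumes "N > 0" "unitary_mat N A" "x \<in> {0..<1}" "t \<in> {0..<1}"
  shows "(\<Sum>i<N. walsh_m N A i x * cnj (walsh_m N A i t)) =
    (if \<lfloor>real N * x\<rfloor> = \<lfloor>real N * t\<rfloor> then of_nat N else 0)"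
proof -
  let ?j = "nat \<lfloor>real N * x\<rfloor>" and ?l = "nat \<lfloor>real N * t\<rfloor>"
  have sq: "complex_of_real (sqrt (real N)) * complex_of_real (sqrt (real N)) = of_nat N"
    by (simp flip: of_real_mult)
  have "(\<Sum>i<N. walsh_m N A i x * cnj (walsh_m N A i t)) =
      (\<Sum>i<N. (complex_of_real (sqrt (real N)) * complex_of_real (sqrt (real N))) *
        (A $$ (i, ?j) * cnj (A $$ (i, ?l))))"
    using assms by (simp add: walsh_m_eq ac_simps)
  also have "\<dots> = of_nat N * (if ?j = ?l then 1 else 0)"
    unfolding sq using unitary_columns_orthonormal[OF assms(2) walsh_m_eq(2) walsh_m_eq(2)] assms
    by (simp flip: sum_distrib_left)
  also have "?j = ?l \<longleftrightarrow> \<lfloor>real N * x\<rfloor> = \<lfloor>real N * t\<rfloor>"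
    using assms by (auto simp: eq_nat_nat_iff)
  finally show ?thesis by simp
qed

text \<open>Splitting off the lowest digit of \<open>n\<close>, which goes with the leading digit of \<open>x\<close>, leaves a product of the same form at
\<open>r x\<close>. This is what drives the induction on \<open>q\<close> in the kernel formula.\<close>

lemma digit_prod_Suc:
  assumes "i < N"
  shows "digit_prod N A (Suc q) (i + m * N) x = walsh_m N A i x * digit_prod N A q m (walsh_r N x)"
proof -
  have "(i + m * N) div (N * N ^ k) = m div N ^ k" for k
    using assms by (simp add: div_mult2_eq)
  then show ?thesis
    using assms unfolding digit_prod_def prod.lessThan_Suc_shift
    by (simp add: funpow_swap1)
qed

text \<open>The index of the cell of level \<open>Suc q\<close> containing \<open>x\<close> is \<open>N ^ q\<close> times the leading digit of \<open>x\<close> plus the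
index, below \<open>N ^ q\<close>, of the cell of level \<open>q\<close> containing \<open>r x\<close>.\<close>

lemma floor_eq_adic_Suc:
  assumes "N > 0" "x \<in> {0..<1}" "t \<in> {0..<1}"
  shows "\<lfloor>real (N ^ Suc q) * x\<rfloor> = \<lfloor>real (N ^ Suc q) * t\<rfloor> \<longleftrightarrow>
    \<lfloor>real N * x\<rfloor> = \<lfloor>real N * t\<rfloor> \<and>
    \<lfloor>real (N ^ q) * walsh_r N x\<rfloor> = \<lfloor>real (N ^ q) * walsh_r N t\<rfloor>"
proof -
  have split: "\<lfloor>real (N ^ Suc q) * y\<rfloor> = int (N ^ q) * \<lfloor>real N * y\<rfloor> + \<lfloor>real (N ^ q) * walsh_r N y\<rfloor>"
    if "y \<in> {0..<1}" for y
  proof -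
    have "real (N ^ Suc q) * y = of_int (int (N ^ q) * \<lfloor>real N * y\<rfloor>) + real (N ^ q) * walsh_r N y"
      using that by (simp add: walsh_r_def frac_def algebra_simps)
    then show ?thesis
      by (metis add.commute floor_add_int)
  qed
  have range: "0 \<le> \<lfloor>real (N ^ q) * walsh_r N y\<rfloor>" "\<lfloor>real (N ^ q) * walsh_r N y\<rfloor> < int (N ^ q)"
    if "y \<in> {0..<1}" for y
    using walsh_r_range[OF that, of N] assms(1) by (auto simp: floor_less_iff)
  have "\<lfloor>real N * y\<rfloor> = \<lfloor>real (N ^ Suc q) * y\<rfloor> div int (N ^ q)" if "y \<in> {0..<1}" for y
    using range[OF that] assms(1) unfolding split[OF that] by simp
  then show ?thesis
    using split assms(2,3) by (metis add_left_cancel)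
qed

text \<open>Writing \<open>n = i + m N\<close>, the sum factorises into the kernel of the functions \<open>m\<^sub>i\<close> at \<open>(x, t)\<close> and the kernel of level
\<open>q\<close> at \<open>(r x, r t)\<close>.\<close>

lemma digit_prod_kernel:
  assumes "N > 0" "unitary_mat N A" "x \<in> {0..<1}" "t \<in> {0..<1}"
  shows "(\<Sum>n<N ^ q. digit_prod N A q n x * cnj (digit_prod N A q n t)) =
    (if \<lfloor>real (N ^ q) * x\<rfloor> = \<lfloor>real (N ^ q) * t\<rfloor> then of_nat (N ^ q) else 0)"
  using assms(3,4)
proof (induction q arbitrary: x t)
  case 0
  then have "\<lfloor>x\<rfloor> = 0" "\<lfloor>t\<rfloor> = 0" by (simp_all add: floor_eq_iff)
  then show ?case by (simp add: digit_prod_def)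
next
  case (Suc q)
  let ?f = "\<lambda>n. digit_prod N A (Suc q) n x * cnj (digit_prod N A (Suc q) n t)"
  let ?x = "walsh_r N x" and ?t = "walsh_r N t"
  have shift: "sum g {m * N..<m * N + N} = (\<Sum>i<N. g (i + m * N))" for g :: "nat \<Rightarrow> complex" and m
    using sum.shift_bounds_nat_ivl[of g 0 "m * N" N] by (simp add: lessThan_atLeast0 add.commute)
  have "(\<Sum>n<N ^ Suc q. ?f n) = (\<Sum>m<N ^ q. sum ?f {m * N..<m * N + N})"
    by (simp add: sum.nat_group mult.commute)
  also have "\<dots> = (\<Sum>m<N ^ q. \<Sum>i<N. ?f (i + m * N))"
    by (simp only: shift)
  also have "\<dots> = (\<Sum>m<N ^ q. \<Sum>i<N. (walsh_m N A i x * cnj (walsh_m N A i t)) *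
      (digit_prod N A q m ?x * cnj (digit_prod N A q m ?t)))"
    by (intro sum.cong refl) (simp add: digit_prod_Suc ac_simps)
  also have "\<dots> = (\<Sum>i<N. walsh_m N A i x * cnj (walsh_m N A i t)) *
      (\<Sum>m<N ^ q. digit_prod N A q m ?x * cnj (digit_prod N A q m ?t))"
    by (subst sum.swap) (simp add: sum_product)
  also have "\<dots> = (if \<lfloor>real N * x\<rfloor> = \<lfloor>real N * t\<rfloor> then of_nat N else 0) *
      (if \<lfloor>real (N ^ q) * ?x\<rfloor> = \<lfloor>real (N ^ q) * ?t\<rfloor> then of_nat (N ^ q) else 0)"
    using Suc.prems Suc.IH walsh_r_range walsh_m_kernel[OF assms(1,2)] by presburger
  also have "\<dots> = (if \<lfloor>real (N ^ Suc q) * x\<rfloor> = \<lfloor>real (N ^ Suc q) * t\<rfloor> then of_nat (N ^ Suc q) else 0)"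
    using floor_eq_adic_Suc[OF assms(1) Suc.prems, of q] by (auto simp del: of_nat_power)
  finally show ?case .
qed

lemma walsh_eq_digit_prod:
  assumes N: "N > 0" and row0: "\<And>j. j < N \<Longrightarrow> A $$ (0, j) = complex_of_real (1 / sqrt (real N))"
    and n: "n < N ^ q" and x: "x \<in> {0..<1}"
  shows "walsh N A n x = digit_prod N A q n x"
proof -
  have le: "num_digits N n \<le> q"
    unfolding num_digits_def using n by (rule Least_le)
  have lt: "n < N ^ num_digits N n"
    unfolding num_digits_def using n by (rule LeastI)
  have "walsh_m N A (n div N ^ k mod N) ((walsh_r N ^^ k) x) = 1" if "num_digits N n \<le> k" for k
  proof -
    have "N ^ num_digits N n \<le> N ^ k"
      using that N by (intro power_increasing) auto
    then have "n div N ^ k = 0"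
      using lt by simp
    moreover have "walsh_m N A 0 y = 1" if "y \<in> {0..<1}" for y
      using walsh_m_eq(1)[OF N that, of A 0] walsh_m_eq(2)[OF N that] row0 N by (simp flip: of_real_mult)
    ultimately show ?thesis
      using walsh_r_funpow_range[OF x] by simp
  qed
  then show ?thesis
    unfolding walsh_def digit_prod_def using le
    by (intro prod.mono_neutral_left) auto
qed

theorem walsh_kernel:
  assumes "N > 0" "unitary_mat N A"
    and "\<And>j. j < N \<Longrightarrow> A $$ (0, j) = complex_of_real (1 / sqrt (real N))"
    and "x \<in> {0..<1}" "t \<in> {0..<1}"
  shows "(\<Sum>n<N ^ q. walsh N A n x * cnj (walsh N A n t)) =
    of_nat (N ^ q) * indicator (adic_cell N q x) t"
proof -
  have "(\<Sum>n<N ^ q. walsh N A n x * cnj (walsh N A n t)) =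
      (\<Sum>n<N ^ q. digit_prod N A q n x * cnj (digit_prod N A q n t))"
    using assms by (intro sum.cong) (simp_all add: walsh_eq_digit_prod)
  then show ?thesis
    using digit_prod_kernel[OF assms(1,2,4,5), of q]
    by (auto simp: adic_cell_def indicator_def simp del: of_nat_power)
qed

lemma walsh_measurable_borel: "walsh N A n \<in> borel_measurable borel"
proof -
  have [measurable]: "walsh_m N A i \<in> borel_measurable borel" for i
    unfolding walsh_m_def[abs_def] by measurable
  have [measurable]: "walsh_r N \<in> borel_measurable borel"
    unfolding walsh_r_def[abs_def] frac_def by measurable
  show ?thesis
    unfolding walsh_def[abs_def] by measurable
qed

lemma walsh_measurable [measurable]: "walsh N A n \<in> borel_measurable unit_leb"
  using walsh_measurable_borel[of N A n]
  by (intro measurable_restrict_space1 measurable_completion) simp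

text \<open>Boundedness makes the product of a Walsh function with a merely integrable function integrable.\<close>

lemma walsh_bounded:
  assumes "N > 0"
  obtains B where "\<And>x. norm (walsh N A n x) \<le> B"
proof -
  define C where "C i = sqrt (real N) * (\<Sum>j<N. norm (A $$ (i, j)))" for i
  have C: "norm (walsh_m N A i x) \<le> C i" for i x
  proof (cases "x = 1")
    case True
    have "norm (A $$ (i, N - 1)) \<le> (\<Sum>j<N. norm (A $$ (i, j)))"
      using assms by (intro member_le_sum) auto
    then show ?thesis
      using True by (simp add: walsh_m_def C_def norm_mult mult_left_mono)
  next
    case False
    have "norm (\<Sum>j<N. A $$ (i, j) * indicator {real j / real N ..< (real j + 1) / real N} x)
        \<le> (\<Sum>j<N. norm (A $$ (i, j)))"
      by (rule sum_norm_le) (simp add: indicator_def norm_mult)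
    then show ?thesis
      using False by (simp add: walsh_m_def C_def norm_mult mult_left_mono)
  qed
  have "norm (walsh N A n x) \<le> (\<Prod>k<num_digits N n. C (n div N ^ k mod N))" for x
    unfolding walsh_def by (rule order_trans[OF norm_prod_le prod_mono]) (use C in auto)
  then show ?thesis
    by (rule that)
qed

lemma AE_unit_leb_less_1: "AE x in unit_leb. x \<in> {0..<1}"
proof -
  have "{1} \<in> null_sets (lebesgue :: real measure)"
    by (simp add: negligible_iff_null_sets[symmetric])
  then have "AE x in lebesgue. x \<notin> {1 :: real}"
    by (rule AE_not_in)
  then show ?thesis
    by (subst AE_restrict_space_iff) (auto elim!: eventually_mono)
qed

text \<open>Interchanging the finite sum with the integrals defining the coefficients gives the integral of \<open>f\<close> against the kernel.
The endpoint \<open>t = 1\<close>, where the Walsh functions are given by a convention of their own, is a null set.\<close>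

lemma walsh_sum_eq_cell_avg:
  assumes N: "N > 0" and A: "unitary_mat N A"
    and row0: "\<And>j. j < N \<Longrightarrow> A $$ (0, j) = complex_of_real (1 / sqrt (real N))"
    and f: "integrable unit_leb f" and x: "x \<in> {0..<1}"
  shows "walsh_sum N A (N ^ q) f x = cell_avg N q (\<lambda>t. indicator {0..1} t *\<^sub>R f t) x"
proof -
  have [measurable]: "f \<in> borel_measurable unit_leb" using f by simp
  have [measurable]: "cnj \<in> borel_measurable borel"
    by (intro borel_measurable_continuous_onI continuous_intros)
  have int: "integrable unit_leb (\<lambda>t. f t * cnj (walsh N A n t))" for n
  proof -
    obtain B where B: "norm (walsh N A n t) \<le> B" for t
      using walsh_bounded[OF N] by metis
    show ?thesis
    proof (rule Bochner_Integration.integrable_bound)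
      show "integrable unit_leb (\<lambda>t. norm (f t) * B)"
        using f by simp
      have "norm (f t * cnj (walsh N A n t)) \<le> norm (norm (f t) * B)" for t
        using B[of t] by (simp add: norm_mult abs_mult) (meson abs_ge_self mult_left_mono norm_ge_zero order_trans)
      then show "AE t in unit_leb. norm (f t * cnj (walsh N A n t)) \<le> norm (norm (f t) * B)"
        by simp
    qed measurable
  qed
  have "walsh_sum N A (N ^ q) f x
      = (\<Sum>n<N ^ q. LINT t|unit_leb. walsh N A n x * (f t * cnj (walsh N A n t)))"
    unfolding walsh_sum_def inner_L2_def using int by (intro sum.cong) (simp_all add: mult.commute)
  also have "\<dots> = (LINT t|unit_leb. (\<Sum>n<N ^ q. walsh N A n x * (f t * cnj (walsh N A n t))))"
    using int by (subst Bochner_Integration.integral_sum) simp_all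
  also have "\<dots> = (LINT t|unit_leb. real (N ^ q) *\<^sub>R (indicator (adic_cell N q x) t *\<^sub>R f t))"
  proof (rule integral_cong_AE)
    show "AE t in unit_leb. (\<Sum>n<N ^ q. walsh N A n x * (f t * cnj (walsh N A n t)))
        = real (N ^ q) *\<^sub>R (indicator (adic_cell N q x) t *\<^sub>R f t)"
      using AE_unit_leb_less_1
    proof eventually_elim
      case (elim t)
      have "(\<Sum>n<N ^ q. walsh N A n x * (f t * cnj (walsh N A n t)))
          = f t * (\<Sum>n<N ^ q. walsh N A n x * cnj (walsh N A n t))"
        by (simp add: sum_distrib_left ac_simps)
      also have "\<dots> = f t * (of_nat (N ^ q) * indicator (adic_cell N q x) t)"
        by (simp only: walsh_kernel[OF N A row0 x elim])
      finally show ?case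
        by (simp add: indicator_def scaleR_conv_of_real)
    qed
    have [measurable]: "indicator (adic_cell N q x) \<in> borel_measurable unit_leb"
      by (intro measurable_restrict_space1) simp
    show "(\<lambda>t. real (N ^ q) *\<^sub>R (indicator (adic_cell N q x) t *\<^sub>R f t)) \<in> borel_measurable unit_leb"
      by measurable
  qed measurable
  also have "\<dots> = real (N ^ q) *\<^sub>R (LINT t|unit_leb. indicator (adic_cell N q x) t *\<^sub>R f t)"
    by (rule integral_scaleR_right)
  also have "(LINT t|unit_leb. indicator (adic_cell N q x) t *\<^sub>R f t)
      = (LINT t|lebesgue. indicator (adic_cell N q x) t *\<^sub>R (indicator {0..1} t *\<^sub>R f t))"
    by (subst integral_restrict_space) (simp_all add: ac_simps)
  finally show ?thesis
    by (simp add: cell_avg_def)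
qed

section \<open>Convergence of Walsh series\<close>

lemma finite_measure_unit_leb: "finite_measure unit_leb"
  by (intro finite_measure_lebesgue_on) simp

text \<open>For finite exponents this rests on \<open>\<bar>f\<bar> \<le> 1 + \<bar>f\<bar>\<^sup>p\<close>.\<close>

lemma mem_Lp_imp_integrable:
  assumes "finite_measure M" "1 \<le> p" "mem_Lp p M f"
  shows "integrable M f"
proof -
  interpret finite_measure M by fact
  have f [measurable]: "f \<in> borel_measurable M"
    using assms(3) by (simp add: mem_Lp_def)
  show ?thesis
  proof (cases "p = \<infinity>")
    case True
    then have "esssup M (\<lambda>x. ennreal (norm (f x))) < \<infinity>"
      using assms(3) by (simp add: mem_Lp_def)
    then obtain C where C: "C \<ge> 0" "esssup M (\<lambda>x. ennreal (norm (f x))) = ennreal C"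
      by (cases "esssup M (\<lambda>x. ennreal (norm (f x)))") auto
    have "AE x in M. norm (f x) \<le> C"
      using esssup_AE[of "\<lambda>x. ennreal (norm (f x))" M]
      by eventually_elim (use C in \<open>simp add: ennreal_le_iff\<close>)
    then show ?thesis
      using f by (rule integrable_const_bound)
  next
    case False
    define r where "r = enn2real p"
    have r: "r \<ge> 1"
      using False assms(2) by (cases p) (auto simp: r_def ennreal_less_iff simp flip: ennreal_1)
    have "(\<integral>\<^sup>+ x. ennreal (norm (f x) powr r) \<partial>M) < \<infinity>"
      using assms(3) False by (simp add: mem_Lp_def r_def)
    then have "integrable M (\<lambda>x. norm (f x) powr r)"
      by (simp add: integrable_iff_bounded)
    then have "integrable M (\<lambda>x. 1 + norm (f x) powr r)"
      by simp
    then show ?thesis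
    proof (rule Bochner_Integration.integrable_bound)
      have "norm (f x) \<le> 1 + norm (f x) powr r" for x
        using powr_mono[of 1 r "norm (f x)"] r
        by (cases "norm (f x) \<le> 1") (auto simp: add_increasing2)
      then show "AE x in M. norm (f x) \<le> norm (1 + norm (f x) powr r)"
        by (intro AE_I2 order_trans[OF _ abs_ge_self]) simp
    qed (rule f)
  qed
qed

lemma AE_unit_lebI: "AE x in lebesgue. P x \<Longrightarrow> AE x in unit_leb. P x"
  by (subst AE_restrict_space_iff) (auto elim!: eventually_mono)

lemma nn_integral_unit_leb_le:
  assumes "AE x in unit_leb. g x \<le> h x"
  shows "(\<integral>\<^sup>+ x. g x \<partial>unit_leb) \<le> (\<integral>\<^sup>+ x. h x \<partial>lebesgue)"
proof -
  have "(\<integral>\<^sup>+ x. g x \<partial>unit_leb) \<le> (\<integral>\<^sup>+ x. h x \<partial>unit_leb)"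
    using assms by (rule nn_integral_mono_AE)
  also have "\<dots> = (\<integral>\<^sup>+ x. h x * indicator {0..1} x \<partial>lebesgue)"
    by (rule nn_integral_restrict_space) simp
  also have "\<dots> \<le> (\<integral>\<^sup>+ x. h x \<partial>lebesgue)"
    by (intro nn_integral_mono) (simp add: indicator_def)
  finally show ?thesis .
qed

lemma tendsto_LpI:
  fixes p :: ennreal
  assumes p: "1 < p" "p < \<infinity>"
    and mem: "\<And>q. mem_Lp p M (F q)" "mem_Lp p M f"
    and lim: "(\<lambda>q. \<integral>\<^sup>+ x. ennreal (norm (F q x - f x) powr enn2real p) \<partial>M) \<longlonglongrightarrow> 0"
  shows "tendsto_Lp p M F f"
proof -
  define r where "r = enn2real p"
  have r: "r > 1"
    using p by (cases p) (auto simp: r_def ennreal_less_iff simp flip: ennreal_1)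
  have [measurable]: "F q \<in> borel_measurable M" "f \<in> borel_measurable M" for q
    using mem by (auto simp: mem_Lp_def)
  have "norm_Lp p M (\<lambda>x. F q x - f x)
      = enn2real (\<integral>\<^sup>+ x. ennreal (norm (F q x - f x) powr r) \<partial>M) powr (1 / r)" for q
    using p by (simp add: norm_Lp_def r_def integral_eq_nn_integral)
  moreover have "(\<lambda>q. enn2real (\<integral>\<^sup>+ x. ennreal (norm (F q x - f x) powr r) \<partial>M) powr (1 / r)) \<longlonglongrightarrow> 0 powr (1 / r)"
  proof (rule tendsto_powr2)
    show "(\<lambda>q. enn2real (\<integral>\<^sup>+ x. ennreal (norm (F q x - f x) powr r) \<partial>M)) \<longlonglongrightarrow> 0"
      using tendsto_enn2real[of "\<lambda>q. \<integral>\<^sup>+ x. ennreal (norm (F q x - f x) powr r) \<partial>M" 0 sequentially] lim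
      by (simp add: r_def)
  qed (use r in auto)
  ultimately show ?thesis
    using mem by (simp add: tendsto_Lp_def)
qed

theorem corollary2p8:
  fixes N :: nat and A :: "complex mat" and p :: ennreal and f :: "real \<Rightarrow> complex"
  assumes "N \<ge> 2"
    and "unitary_mat N A"
    and "\<And>j. j < N \<Longrightarrow> A $$ (0, j) = complex_of_real (1 / sqrt (real N))"
    and "1 \<le> p"
    and "mem_Lp p unit_leb f"
  shows "(AE x in unit_leb. (\<lambda>q. walsh_sum N A (N ^ q) f x) \<longlonglongrightarrow> f x) \<and>
    (1 < p \<and> p < \<infinity> \<longrightarrow> tendsto_Lp p unit_leb (\<lambda>q. walsh_sum N A (N ^ q) f) f)"
proof
  have N0: "N > 0" using assms(1) by simp
  define F where "F t = indicator {0..1} t *\<^sub>R f t" for t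
  have f: "integrable unit_leb f"
    using mem_Lp_imp_integrable[OF finite_measure_unit_leb assms(4,5)] .
  then have F: "integrable lebesgue F"
    unfolding F_def by (subst (asm) integrable_restrict_space) simp_all
  have Ff: "F x = f x" if "x \<in> {0..<1}" for x
    using that by (simp add: F_def)
  have S: "walsh_sum N A (N ^ q) f x = cell_avg N q F x" if "x \<in> {0..<1}" for q x
    unfolding F_def by (rule walsh_sum_eq_cell_avg[OF N0 assms(2,3) f that])
  show "AE x in unit_leb. (\<lambda>q. walsh_sum N A (N ^ q) f x) \<longlonglongrightarrow> f x"
    using AE_unit_lebI[OF AE_cell_avg_tendsto[OF assms(1) F]] AE_unit_leb_less_1
    by eventually_elim (simp only: S Ff)
  show "1 < p \<and> p < \<infinity> \<longrightarrow> tendsto_Lp p unit_leb (\<lambda>q. walsh_sum N A (N ^ q) f) f"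
  proof
    assume p: "1 < p \<and> p < \<infinity>"
    define r where "r = enn2real p"
    have r: "r > 1"
      using p by (cases p) (auto simp: r_def ennreal_less_iff simp flip: ennreal_1)
    have [measurable]: "f \<in> borel_measurable unit_leb" "F \<in> borel_measurable lebesgue"
      using f F by auto
    have "(\<integral>\<^sup>+ x. ennreal (norm (F x) powr r) \<partial>lebesgue) = (\<integral>\<^sup>+ x. ennreal (norm (f x) powr r) \<partial>unit_leb)"
      by (subst nn_integral_restrict_space) (auto simp: F_def indicator_def intro!: nn_integral_cong)
    also have "\<dots> < \<infinity>"
      using assms(5) p by (auto simp: mem_Lp_def r_def split: if_splits)
    finally have Fr: "(\<integral>\<^sup>+ x. ennreal (norm (F x) powr r) \<partial>lebesgue) < \<infinity>" .
    then have Fr_int: "integrable lebesgue (\<lambda>x. norm (F x) powr r)"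
      by (simp add: integrable_iff_bounded)
    show "tendsto_Lp p unit_leb (\<lambda>q. walsh_sum N A (N ^ q) f) f"
    proof (rule tendsto_LpI)
      show "mem_Lp p unit_leb (walsh_sum N A (N ^ q) f)" for q
      proof -
        have [measurable]: "walsh_sum N A (N ^ q) f \<in> borel_measurable unit_leb"
          unfolding walsh_sum_def[abs_def] by measurable
        have "(\<integral>\<^sup>+ x. ennreal (norm (walsh_sum N A (N ^ q) f x) powr r) \<partial>unit_leb)
            \<le> (\<integral>\<^sup>+ x. cell_nn_avg N q (\<lambda>t. ennreal (norm (F t) powr r)) x \<partial>lebesgue)"
          by (rule nn_integral_unit_leb_le)
            (use AE_unit_leb_less_1 in \<open>eventually_elim,
              use norm_cell_avg_powr_le[OF N0 F] r S in simp\<close>)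
        also have "\<dots> < \<infinity>"
          using Fr by (subst nn_integral_cell_nn_avg[OF N0]) simp_all
        finally show ?thesis
          using p by (auto simp: mem_Lp_def r_def)
      qed
      have bound: "(\<integral>\<^sup>+ x. ennreal (norm (walsh_sum N A (N ^ q) f x - f x) powr r) \<partial>unit_leb)
          \<le> (\<integral>\<^sup>+ x. ennreal (norm (cell_avg N q F x - F x) powr r) \<partial>lebesgue)" for q
        by (rule nn_integral_unit_leb_le)
          (use AE_unit_leb_less_1 in \<open>eventually_elim, use S Ff in simp\<close>)
      show "(\<lambda>q. \<integral>\<^sup>+ x. ennreal (norm (walsh_sum N A (N ^ q) f x - f x) powr enn2real p) \<partial>unit_leb) \<longlonglongrightarrow> 0"
        unfolding r_def[symmetric]
        by (rule tendsto_sandwich[OF _ _ tendsto_const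
              cell_avg_tendsto_Lp[OF assms(1) F less_imp_le[OF r] Fr_int]]) (use bound in auto)
    qed (use p assms(5) in auto)
  qed
qed

end
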